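(* Let $L\ge 1$ and $d=d_0,d_1,\dots,d_{L-1},d_L=1\in\mathbb N$ (positive integers). There exist $n,m\in\mathbb N$ such that every function in $\mathbf{ReLU}(d,d_1,\dots,d_{L-1},1)$ equals $g_\theta\oslash h_\theta$ for some $\theta\in\Theta(d,n,m)$, and there is a semialgebraic set $\mathcal S\subseteq\Theta(d,n,m)$ such that $$\{g_\theta\oslash h_\theta\mid\theta\in\mathcal S\}=\mathbf{ReLU}(d,d_1,\dots,d_{L-1},1).$$ This semialgebraic set can be described by polynomial inequalities of degree at most $L+1$. The numbers $n,m$ can be chosen such that $n=2m$ and $$\log_2(m)\le\sum_{k=1}^{L-1}2^{L-1-k}\prod_{l=k}^{L-1}d_l .$$
   Context: $\mathbf{ReLU}(d_0,d_1,\dots,d_L)$ is the set of functions $f:\mathbb R^{d_0}\to\mathbb R^{d_L}$ of the form $f=\sigma^{(L)}\circ\varphi^{(L)}\circ\cdots\circ\sigma^{(1)}\circ\varphi^{(1)}$, where $\varphi^{(\ell)}:\mathbb R^{d_{\ell-1}}\to\mathbb R^{d_\ell}$, $\varphi^{(\ell)}(x)=W^{(\ell)}x+c^{(\ell)}$ with arbitrary $W^{(\ell)}\in\mathbb R^{d_\ell\times d_{\ell-1}}$, $c^{(\ell)}\in\mathbb R^{d_\ell}$, and $\sigma^{(\ell)}(x_1,\dots,x_{d_\ell})=(\max(x_1,0),\dots,\max(x_{d_\ell},0))$ for every $\ell\in[L]$ (including the last layer). $\Theta(d,n,m)\cong\mathbb R^{(n+m)(d+1)}$ is the space of parameters $\theta=(a_1,\mathbf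 s_1,\dots,a_n,\mathbf s_n,b_1,\mathbf t_1,\dots,b_m,\mathbf t_m)$ with $a_i,b_j\in\mathbb R$ and $\mathbf s_i,\mathbf t_j\in\mathbb R^d$. Each $\theta$ defines the tropical rational function $g_\theta\oslash h_\theta:\mathbb R^d\to\mathbb R$, $$(g_\theta\oslash h_\theta)(\mathbf x)=\max_{i\in[n]}(a_i+\langle\mathbf s_i,\mathbf x\rangle)-\max_{j\in[m]}(b_j+\langle\mathbf t_j,\mathbf x\rangle).$$ *)

theory Defs
  imports Complex_Main "HOL-Library.FuncSet" "HOL-Library.Poly_Mapping" "Jordan_Normal_Form.Matrix"
begin

definition relu :: "real vec \<Rightarrow> real vec" where
  "relu x = map_vec (\<lambda>t. max t 0) x"

fun relu_net :: "(nat \<Rightarrow> real mat) \<Rightarrow> (nat \<Rightarrow> real vec) \<Rightarrow> nat \<Rightarrow> real vec \<Rightarrow> real vec" where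
  "relu_net W c 0 x = x"
| "relu_net W c (Suc l) x = relu (W (Suc l) *\<^sub>v relu_net W c l x + c (Suc l))"

text \<open>The set \<open>ReLU(d 0, \<dots>, d L)\<close>. Functions on \<open>\<real>\<^sup>N\<close> are represented as extensional functions on
  \<open>carrier_vec N\<close>, so that HOL equality is equality of functions on \<open>\<real>\<^sup>N\<close>.\<close>

definition ReLU :: "(nat \<Rightarrow> nat) \<Rightarrow> nat \<Rightarrow> (real vec \<Rightarrow> real vec) set" where
  "ReLU d L = {restrict (relu_net W c L) (carrier_vec (d 0)) | W c.
     \<forall>l\<in>{1..L}. W l \<in> carrier_mat (d l) (d (l - 1)) \<and> c l \<in> carrier_vec (d l)}"

text \<open>For \<open>d L = 1\<close>: the same set under the identification of \<open>\<real>\<^sup>1\<close> with \<open>\<real>\<close>.\<close>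

definition ReLU_scalar :: "(nat \<Rightarrow> nat) \<Rightarrow> nat \<Rightarrow> (real vec \<Rightarrow> real) set" where
  "ReLU_scalar d L = (\<lambda>f. \<lambda>x\<in>carrier_vec (d 0). f x $ 0) ` ReLU d L"

text \<open>A parameter \<open>(a\<^sub>1, s\<^sub>1, \<dots>, a\<^sub>n, s\<^sub>n, b\<^sub>1, t\<^sub>1, \<dots>, b\<^sub>m, t\<^sub>m)\<close> is a vector of \<open>n + m\<close> consecutive
  blocks of length \<open>d + 1\<close>; blocks are counted from 0, so \<open>(b\<^sub>j, t\<^sub>j)\<close> is block \<open>n + j - 1\<close>.\<close>

definition Theta :: "nat \<Rightarrow> nat \<Rightarrow> nat \<Rightarrow> real vec set" where
  "Theta d n m = carrier_vec ((n + m) * (d + 1))"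

definition block_const :: "nat \<Rightarrow> real vec \<Rightarrow> nat \<Rightarrow> real" where
  "block_const d \<theta> i = \<theta> $ (i * (d + 1))"

definition block_slope :: "nat \<Rightarrow> real vec \<Rightarrow> nat \<Rightarrow> real vec" where
  "block_slope d \<theta> i = vec d (\<lambda>k. \<theta> $ (i * (d + 1) + 1 + k))"

definition block_affine :: "nat \<Rightarrow> real vec \<Rightarrow> nat \<Rightarrow> real vec \<Rightarrow> real" where
  "block_affine d \<theta> i x = block_const d \<theta> i + block_slope d \<theta> i \<bullet> x"

text \<open>Only meaningful for \<open>n, m \<ge> 1\<close>: \<open>Max {}\<close> is unspecified.\<close>

definition trop_rat :: "nat \<Rightarrow> nat \<Rightarrow> nat \<Rightarrow> real vec \<Rightarrow> (real vec \<Rightarrow> real)" where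
  "trop_rat d n m \<theta> = (\<lambda>x\<in>carrier_vec d.
     (MAX i\<in>{..<n}. block_affine d \<theta> i x) - (MAX j\<in>{..<m}. block_affine d \<theta> (n + j) x))"

text \<open>A real polynomial in the variables \<open>X\<^sub>0, X\<^sub>1, \<dots>\<close> is a finitely supported map from
  monomials (finitely supported exponent vectors) to coefficients.\<close>

type_synonym real_mpoly = "(nat \<Rightarrow>\<^sub>0 nat) \<Rightarrow>\<^sub>0 real"

definition monom_degree :: "(nat \<Rightarrow>\<^sub>0 nat) \<Rightarrow> nat" where
  "monom_degree e = (\<Sum>i\<in>Poly_Mapping.keys e. Poly_Mapping.lookup e i)"

definition eval_mpoly :: "real_mpoly \<Rightarrow> real vec \<Rightarrow> real" where
  "eval_mpoly p x = (\<Sum>e\<in>Poly_Mapping.keys p. Poly_Mapping.lookup p e *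
     (\<Prod>i\<in>Poly_Mapping.keys e. x $ i ^ Poly_Mapping.lookup e i))"

text \<open>Polynomials in \<open>X\<^sub>0, \<dots>, X\<^bsub>N-1\<^esub>\<close> of total degree at most \<open>D\<close>.\<close>

definition polys_deg_le :: "nat \<Rightarrow> nat \<Rightarrow> real_mpoly set" where
  "polys_deg_le N D = {p. \<forall>e\<in>Poly_Mapping.keys p.
     Poly_Mapping.keys e \<subseteq> {..<N} \<and> monom_degree e \<le> D}"

definition basic_semialgebraic :: "nat \<Rightarrow> real_mpoly set \<Rightarrow> real_mpoly set \<Rightarrow> real vec set" where
  "basic_semialgebraic N P Q =
     {x \<in> carrier_vec N. (\<forall>p\<in>P. eval_mpoly p x \<ge> 0) \<and> (\<forall>q\<in>Q. eval_mpoly q x > 0)}"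

text \<open>Semialgebraic subsets of \<open>\<real>\<^sup>N\<close> with a quantifier-free description, as a finite union of
  solution sets of finite systems of weak and strict polynomial inequalities, using only
  polynomials of degree at most \<open>D\<close>. An equation \<open>p = 0\<close> is the pair \<open>p \<ge> 0\<close>, \<open>- p \<ge> 0\<close>.\<close>

definition semialgebraic_deg_le :: "nat \<Rightarrow> nat \<Rightarrow> real vec set \<Rightarrow> bool" where
  "semialgebraic_deg_le N D S \<longleftrightarrow> (\<exists>\<F>. finite \<F> \<and>
     (\<forall>(P, Q)\<in>\<F>. finite P \<and> finite Q \<and> P \<union> Q \<subseteq> polys_deg_le N D) \<and>
     S = (\<Union>(P, Q)\<in>\<F>. basic_semialgebraic N P Q))"

end

theory Submission
  imports Defs
begin

text \<open>
  The plan is to find parameters of a ReLU network that are linear in the coefficients of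
  the tropical rational function and on which the only nonlinear constraints are
  quadratic.

  A network is unrolled into the tree of all backward walks from the output neuron, so
  that a neuron is copied once for each walk that reaches it. Since
  \<open>max (r * y) 0 = r * max y 0\<close> for \<open>r \<ge> 0\<close>, the absolute values of the weights can be
  pushed along the edges towards the leaves. Beyond the first layer, only the sign of each
  weight remains, and each tree node \<open>u\<close> carries an affine function \<open>T u\<close>, constant unless
  \<open>u\<close> lies in the first layer (lemma \<open>net_eq_unrolled_tree\<close>).

  Once the signs are fixed, the tree computes a difference of two maxima whose members are
  sums \<open>\<Sum>u\<in>A. T u\<close> over sets \<open>A\<close> of tree nodes (lemma \<open>tree_val_eq_diff_max\<close>).
  Only the first maximum uses sets that contain the root. With \<open>N\<close> the number of nodes
  other than the root this gives at most \<open>2 ^ (N + 1)\<close> and \<open>2 ^ N\<close> members, whence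
  \<open>n = 2 m\<close> with \<open>m = 2 ^ N\<close>, and \<open>N\<close> is at most the required exponent (lemma
  \<open>card_paths_bound\<close>). The coefficients of the tropical rational function depend linearly
  on \<open>T\<close>, and conversely \<open>T\<close> is read off from them: for each node \<open>u\<close> two of the sets
  differ exactly by \<open>u\<close> (lemma \<open>pieces_separate_paths\<close>).

  It remains to recognise the families \<open>T\<close> that come from a network. The subtrees hanging
  at different copies of the same neuron must be nonnegative multiples of each other,
  which says that certain two by two minors vanish and certain products are nonnegative.
  These conditions also suffice, because the factors of proportionality can be used as the
  weights (lemma \<open>realizable_imp_net\<close>). They are quadratic, and \<open>2 \<le> L + 1\<close>. The union
  over the finitely many sign patterns is the desired semialgebraic set.
\<close>

section \<open>Systems of polynomial inequalities\<close>

definition monomial_value :: "(nat \<Rightarrow>\<^sub>0 nat) \<Rightarrow> real vec \<Rightarrow> real" where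
  "monomial_value e x = (\<Prod>i\<in>Poly_Mapping.keys e. x $ i ^ Poly_Mapping.lookup e i)"

lemma monomial_value_superset:
  assumes "finite K" "Poly_Mapping.keys e \<subseteq> K"
  shows "monomial_value e x = (\<Prod>i\<in>K. x $ i ^ Poly_Mapping.lookup e i)"
  unfolding monomial_value_def using assms
  by (intro prod.mono_neutral_left) (auto simp: in_keys_iff)

lemma monom_degree_superset:
  assumes "finite K" "Poly_Mapping.keys e \<subseteq> K"
  shows "monom_degree e = (\<Sum>i\<in>K. Poly_Mapping.lookup e i)"
  unfolding monom_degree_def using assms
  by (intro sum.mono_neutral_left) (auto simp: in_keys_iff)

lemma monomial_value_add: "monomial_value (e + e') x = monomial_value e x * monomial_value e' x"
proof -
  let ?K = "Poly_Mapping.keys e \<union> Poly_Mapping.keys e'"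
  have "Poly_Mapping.keys (e + e') \<subseteq> ?K" by (rule Poly_Mapping.keys_add)
  then show ?thesis
    by (simp add: monomial_value_superset[of ?K] lookup_add power_add prod.distrib)
qed

lemma monom_degree_add: "monom_degree (e + e') = monom_degree e + monom_degree e'"
proof -
  let ?K = "Poly_Mapping.keys e \<union> Poly_Mapping.keys e'"
  have "Poly_Mapping.keys (e + e') \<subseteq> ?K" by (rule Poly_Mapping.keys_add)
  then show ?thesis
    by (simp add: monom_degree_superset[of ?K] lookup_add sum.distrib)
qed

lemma eval_mpoly_superset:
  assumes "finite K" "Poly_Mapping.keys p \<subseteq> K"
  shows "eval_mpoly p x = (\<Sum>e\<in>K. Poly_Mapping.lookup p e * monomial_value e x)"
  unfolding eval_mpoly_def monomial_value_def using assms
  by (intro sum.mono_neutral_left) (auto simp: in_keys_iff)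

lemma eval_mpoly_add: "eval_mpoly (p + q) x = eval_mpoly p x + eval_mpoly q x"
proof -
  let ?K = "Poly_Mapping.keys p \<union> Poly_Mapping.keys q"
  have "Poly_Mapping.keys (p + q) \<subseteq> ?K" by (rule Poly_Mapping.keys_add)
  then show ?thesis
    by (simp add: eval_mpoly_superset[of ?K] lookup_add distrib_right sum.distrib)
qed

definition polynomial_fun :: "nat \<Rightarrow> nat \<Rightarrow> (real vec \<Rightarrow> real) \<Rightarrow> bool" where
  "polynomial_fun N D F \<longleftrightarrow> (\<exists>p\<in>polys_deg_le N D. \<forall>x. eval_mpoly p x = F x)"

lemma polynomial_fun_add:
  assumes "polynomial_fun N D F" "polynomial_fun N D G"
  shows "polynomial_fun N D (\<lambda>x. F x + G x)"
proof -
  obtain p q where p: "p \<in> polys_deg_le N D" "\<And>x. eval_mpoly p x = F x"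
    and q: "q \<in> polys_deg_le N D" "\<And>x. eval_mpoly q x = G x"
    using assms unfolding polynomial_fun_def by blast
  have "p + q \<in> polys_deg_le N D"
    using p(1) q(1) Poly_Mapping.keys_add[of p q] unfolding polys_deg_le_def by blast
  then show ?thesis
    unfolding polynomial_fun_def using p(2) q(2) by (auto intro!: bexI[of _ "p + q"] simp: eval_mpoly_add)
qed

lemma polynomial_fun_sum:
  assumes "finite I" "\<And>i. i \<in> I \<Longrightarrow> polynomial_fun N D (F i)"
  shows "polynomial_fun N D (\<lambda>x. \<Sum>i\<in>I. F i x)"
  using assms
proof (induction rule: finite_induct)
  case empty
  have "(0 :: real_mpoly) \<in> polys_deg_le N D" by (simp add: polys_deg_le_def)
  moreover have "eval_mpoly 0 x = 0" for x by (simp add: eval_mpoly_def)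
  ultimately show ?case unfolding polynomial_fun_def by auto
next
  case (insert i I)
  then show ?case by (simp add: polynomial_fun_add)
qed

lemma polynomial_fun_monomial:
  assumes "Poly_Mapping.keys e \<subseteq> {..<N}" "monom_degree e \<le> D"
  shows "polynomial_fun N D (\<lambda>x. c * monomial_value e x)"
proof -
  let ?p = "Poly_Mapping.single e c :: real_mpoly"
  have "?p \<in> polys_deg_le N D" using assms by (auto simp: polys_deg_le_def split: if_splits)
  moreover have "eval_mpoly ?p x = c * monomial_value e x" for x
    by (subst eval_mpoly_superset[of "{e}"]) auto
  ultimately show ?thesis unfolding polynomial_fun_def by blast
qed

definition linear_form :: "nat \<Rightarrow> (real vec \<Rightarrow> real) \<Rightarrow> bool" where
  "linear_form N F \<longleftrightarrow> (\<exists>a. \<forall>x. F x = (\<Sum>i<N. a i * x $ i))"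

lemma linear_form_coordinate: "i < N \<Longrightarrow> linear_form N (\<lambda>x. x $ i)"
  unfolding linear_form_def
  by (rule exI[of _ "\<lambda>j. if j = i then 1 else 0"]) (simp add: if_distrib[of "\<lambda>c. c * _"] cong: if_cong)

lemma linear_form_diff:
  assumes "linear_form N F" "linear_form N G"
  shows "linear_form N (\<lambda>x. F x - G x)"
proof -
  obtain a b where "\<And>x. F x = (\<Sum>i<N. a i * x $ i)" "\<And>x. G x = (\<Sum>i<N. b i * x $ i)"
    using assms unfolding linear_form_def by blast
  then show ?thesis unfolding linear_form_def
    by (intro exI[of _ "\<lambda>i. a i - b i"]) (simp add: left_diff_distrib sum_subtractf)
qed

lemma linear_form_zero: "linear_form N (\<lambda>x. 0)"
  unfolding linear_form_def by (rule exI[of _ "\<lambda>_. 0"]) simp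

lemma linear_form_uminus: "linear_form N F \<Longrightarrow> linear_form N (\<lambda>x. - F x)"
  using linear_form_diff[OF linear_form_zero] by simp

lemma linear_form_sum:
  assumes "\<And>u. u \<in> U \<Longrightarrow> linear_form N (F u)"
  shows "linear_form N (\<lambda>x. \<Sum>u\<in>U. F u x)"
proof -
  obtain a where "\<forall>u\<in>U. \<forall>x. F u x = (\<Sum>i<N. a u i * x $ i)"
    using assms unfolding linear_form_def by metis
  then have "(\<Sum>u\<in>U. F u x) = (\<Sum>i<N. (\<Sum>u\<in>U. a u i) * x $ i)" for x
    by (simp add: sum_distrib_right sum.swap[of _ _ U])
  then show ?thesis unfolding linear_form_def
    by (intro exI[of _ "\<lambda>i. \<Sum>u\<in>U. a u i"] allI)
qed

lemma polynomial_fun_linear: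
  assumes "linear_form N F" "D \<ge> 1"
  shows "polynomial_fun N D F"
proof -
  let ?e = "\<lambda>i. Poly_Mapping.single i (1::nat)"
  obtain a where a: "\<And>x. F x = (\<Sum>i<N. a i * x $ i)"
    using assms unfolding linear_form_def by blast
  have "F = (\<lambda>x. \<Sum>i<N. a i * monomial_value (?e i) x)"
    by (auto simp: a monomial_value_def)
  moreover have "polynomial_fun N D \<dots>"
    using assms(2) by (intro polynomial_fun_sum polynomial_fun_monomial) (auto simp: monom_degree_def)
  ultimately show ?thesis by simp
qed

lemma polynomial_fun_mult_linear:
  assumes "linear_form N F" "linear_form N G" "D \<ge> 2"
  shows "polynomial_fun N D (\<lambda>x. F x * G x)"
proof -
  let ?e = "\<lambda>i j. Poly_Mapping.single i (1::nat) + Poly_Mapping.single j 1"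
  obtain a b where a: "\<And>x. F x = (\<Sum>i<N. a i * x $ i)" and b: "\<And>x. G x = (\<Sum>i<N. b i * x $ i)"
    using assms unfolding linear_form_def by blast
  have "(\<lambda>x. F x * G x) = (\<lambda>x. \<Sum>i<N. \<Sum>j<N. (a i * b j) * monomial_value (?e i j) x)"
    by (simp only: a b monomial_value_add sum_product) (auto simp: monomial_value_def intro!: sum.cong)
  moreover have "polynomial_fun N D \<dots>"
  proof (intro polynomial_fun_sum polynomial_fun_monomial)
    fix i j assume "i \<in> {..<N}" "j \<in> {..<N}"
    then show "Poly_Mapping.keys (?e i j) \<subseteq> {..<N}"
      using Poly_Mapping.keys_add[of "Poly_Mapping.single i (1::nat)" "Poly_Mapping.single j 1"]
      by (auto split: if_splits)
    show "monom_degree (?e i j) \<le> D" using assms(3) by (simp only: monom_degree_add) (simp add: monom_degree_def)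
  qed auto
  ultimately show ?thesis by simp
qed

text \<open>Rules that follow the shape of a formula turn conditions written with bounded
  quantifiers into finite lists of inequalities, so that no polynomial has to be written
  down.\<close>

definition polynomial_system :: "nat \<Rightarrow> nat \<Rightarrow> (real vec \<Rightarrow> bool) \<Rightarrow> bool" where
  "polynomial_system N D \<Phi> \<longleftrightarrow> (\<exists>\<C>. finite \<C> \<and> (\<forall>F\<in>\<C>. polynomial_fun N D F) \<and>
     (\<forall>x. \<Phi> x \<longleftrightarrow> (\<forall>F\<in>\<C>. F x \<ge> 0)))"

lemma polynomial_system_nonneg: "polynomial_fun N D F \<Longrightarrow> polynomial_system N D (\<lambda>x. F x \<ge> 0)"
  unfolding polynomial_system_def by (intro exI[of _ "{F}"]) auto

lemma polynomial_system_ball: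
  assumes "finite I" "\<And>i. i \<in> I \<Longrightarrow> polynomial_system N D (\<Phi> i)"
  shows "polynomial_system N D (\<lambda>x. \<forall>i\<in>I. \<Phi> i x)"
proof -
  define Q where "Q i \<C> \<longleftrightarrow> finite \<C> \<and> (\<forall>F\<in>\<C>. polynomial_fun N D F) \<and>
     (\<forall>x. \<Phi> i x \<longleftrightarrow> (\<forall>F\<in>\<C>. F x \<ge> 0))" for i \<C>
  have "\<forall>i\<in>I. \<exists>\<C>. Q i \<C>"
    using assms(2) unfolding polynomial_system_def Q_def by simp
  then obtain \<C> where "\<forall>i\<in>I. Q i (\<C> i)" by metis
  then show ?thesis unfolding polynomial_system_def Q_def
    using assms(1) by (intro exI[of _ "\<Union>i\<in>I. \<C> i"]) simp
qed

lemma polynomial_system_all_less: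
  "(\<And>i. i < n \<Longrightarrow> polynomial_system N D (\<Phi> i)) \<Longrightarrow> polynomial_system N D (\<lambda>x. \<forall>i<(n::nat). \<Phi> i x)"
  using polynomial_system_ball[of "{..<n}" N D \<Phi>] by (simp add: Ball_def)

lemma polynomial_system_all_le:
  "(\<And>i. i \<le> n \<Longrightarrow> polynomial_system N D (\<Phi> i)) \<Longrightarrow> polynomial_system N D (\<lambda>x. \<forall>i\<le>(n::nat). \<Phi> i x)"
  using polynomial_system_ball[of "{..n}" N D \<Phi>] by (simp add: Ball_def)

lemma polynomial_system_conj:
  assumes "polynomial_system N D \<Phi>" "polynomial_system N D \<Psi>"
  shows "polynomial_system N D (\<lambda>x. \<Phi> x \<and> \<Psi> x)"
proof -
  obtain \<C> \<C>' where "finite \<C>" "\<forall>F\<in>\<C>. polynomial_fun N D F" "\<forall>x. \<Phi> x \<longleftrightarrow> (\<forall>F\<in>\<C>. F x \<ge> 0)"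
    and "finite \<C>'" "\<forall>F\<in>\<C>'. polynomial_fun N D F" "\<forall>x. \<Psi> x \<longleftrightarrow> (\<forall>F\<in>\<C>'. F x \<ge> 0)"
    using assms unfolding polynomial_system_def by blast
  then show ?thesis unfolding polynomial_system_def
    by (intro exI[of _ "\<C> \<union> \<C>'"]) (simp add: ball_Un)
qed

lemma polynomial_system_imp:
  "(P \<Longrightarrow> polynomial_system N D \<Phi>) \<Longrightarrow> polynomial_system N D (\<lambda>x. P \<longrightarrow> \<Phi> x)"
  using polynomial_system_ball[of "{u. u = () \<and> P}" N D "\<lambda>_. \<Phi>"] by (cases P) auto

lemma polynomial_system_eq_linear:
  assumes "linear_form N F" "linear_form N G" "D \<ge> 1"
  shows "polynomial_system N D (\<lambda>x. F x = G x)"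
proof -
  have "polynomial_system N D (\<lambda>x. F x - G x \<ge> 0 \<and> G x - F x \<ge> 0)"
    using assms
    by (intro polynomial_system_conj polynomial_system_nonneg polynomial_fun_linear linear_form_diff)
  then show ?thesis by (simp add: order.antisym order_eq_iff conj_commute)
qed

lemma polynomial_system_eq_mult_linear:
  assumes "linear_form N F" "linear_form N G" "linear_form N H" "linear_form N K" "D \<ge> 2"
  shows "polynomial_system N D (\<lambda>x. F x * G x = H x * K x)"
proof -
  have "polynomial_system N D
    (\<lambda>x. F x * G x + (- H x) * K x \<ge> 0 \<and> H x * K x + (- F x) * G x \<ge> 0)"
    using assms
    by (intro polynomial_system_conj polynomial_system_nonneg polynomial_fun_add
        polynomial_fun_mult_linear linear_form_uminus)
  then show ?thesis by (simp add: order_eq_iff conj_commute)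
qed

lemma semialgebraic_Collect_nonneg:
  assumes "finite \<C>" "\<And>F. F \<in> \<C> \<Longrightarrow> polynomial_fun N D F"
  shows "semialgebraic_deg_le N D {x \<in> carrier_vec N. \<forall>F\<in>\<C>. F x \<ge> 0}"
proof -
  obtain p where p: "\<And>F. F \<in> \<C> \<Longrightarrow> p F \<in> polys_deg_le N D"
    "\<And>F x. F \<in> \<C> \<Longrightarrow> eval_mpoly (p F) x = F x"
    using assms(2) unfolding polynomial_fun_def by metis
  have "{x \<in> carrier_vec N. \<forall>F\<in>\<C>. F x \<ge> 0} = basic_semialgebraic N (p ` \<C>) {}"
    by (auto simp: basic_semialgebraic_def p)
  then show ?thesis unfolding semialgebraic_deg_le_def
    using assms(1) p(1) by (intro exI[of _ "{(p ` \<C>, {})}"]) auto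
qed

lemma semialgebraic_polynomial_system:
  assumes "polynomial_system N D \<Phi>"
  shows "semialgebraic_deg_le N D {x \<in> carrier_vec N. \<Phi> x}"
proof -
  obtain \<C> where "finite \<C>" "\<And>F. F \<in> \<C> \<Longrightarrow> polynomial_fun N D F"
    and *: "\<And>x. \<Phi> x \<longleftrightarrow> (\<forall>F\<in>\<C>. F x \<ge> 0)"
    using assms unfolding polynomial_system_def by blast
  then show ?thesis using semialgebraic_Collect_nonneg by simp
qed

lemma semialgebraic_UN:
  assumes "finite I" "\<And>i. i \<in> I \<Longrightarrow> semialgebraic_deg_le N D (S i)"
  shows "semialgebraic_deg_le N D (\<Union>i\<in>I. S i)"
proof -
  define Q where "Q i \<G> \<longleftrightarrow> finite \<G> \<and>
     (\<forall>(P, Q)\<in>\<G>. finite P \<and> finite Q \<and> P \<union> Q \<subseteq> polys_deg_le N D) \<and>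
     S i = (\<Union>(P, Q)\<in>\<G>. basic_semialgebraic N P Q)" for i \<G>
  have "\<forall>i\<in>I. \<exists>\<G>. Q i \<G>"
    using assms(2) unfolding semialgebraic_deg_le_def Q_def by simp
  then obtain \<F> where "\<forall>i\<in>I. Q i (\<F> i)" by metis
  then have *: "\<forall>i\<in>I. finite (\<F> i) \<and>
     (\<forall>(P, Q)\<in>\<F> i. finite P \<and> finite Q \<and> P \<union> Q \<subseteq> polys_deg_le N D) \<and>
     S i = (\<Union>(P, Q)\<in>\<F> i. basic_semialgebraic N P Q)"
    unfolding Q_def .
  show ?thesis unfolding semialgebraic_deg_le_def
  proof (intro exI[of _ "\<Union>i\<in>I. \<F> i"] conjI)
    show "finite (\<Union>i\<in>I. \<F> i)" using assms(1) * by blast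
    show "\<forall>(P, Q)\<in>(\<Union>i\<in>I. \<F> i). finite P \<and> finite Q \<and> P \<union> Q \<subseteq> polys_deg_le N D"
      using * by fast
    have "(\<Union>i\<in>I. S i) = (\<Union>i\<in>I. \<Union>(P, Q)\<in>\<F> i. basic_semialgebraic N P Q)"
      using * by (intro SUP_cong) auto
    then show "(\<Union>i\<in>I. S i) = (\<Union>(P, Q)\<in>(\<Union>i\<in>I. \<F> i). basic_semialgebraic N P Q)"
      by simp
  qed
qed

section \<open>The tree of backward walks\<close>

text \<open>Walks in the network that start at a fixed neuron of layer \<open>l\<close> and go backwards through
  the layers \<open>l - 1, \<dots>, 1\<close>, each given by the list of indices of the neurons visited
  after the start. They are the nodes of the unrolled network, \<open>[]\<close> being the root. Layer
  0 has no walks because the input enters through the affine functions at the nodes of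
  layer 1.\<close>

fun paths :: "(nat \<Rightarrow> nat) \<Rightarrow> nat \<Rightarrow> nat list set" where
  "paths d 0 = {}"
| "paths d (Suc l) = insert [] (\<Union>j<d l. (#) j ` paths d l)"

lemma finite_paths: "finite (paths d l)"
  by (induction l) auto

lemma Nil_in_paths: "l \<ge> 1 \<Longrightarrow> [] \<in> paths d l"
  by (cases l) auto

lemma length_path_less: "p \<in> paths d l \<Longrightarrow> length p < l"
  by (induction l arbitrary: p) auto

lemma append_in_paths:
  "p \<in> paths d l \<Longrightarrow> p @ q \<in> paths d l \<longleftrightarrow> q \<in> paths d (l - length p)"
proof (induction l arbitrary: p)
  case (Suc l)
  then show ?case by (cases p) auto
qed auto

text \<open>Let \<open>N l\<close> be the number counted on the left and \<open>M l\<close> the right-hand side. Removing the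
  root of the tree for layer \<open>l + 2\<close> leaves \<open>d (l + 1)\<close> trees with \<open>1 + N l\<close> nodes each,
  whereas \<open>M (l + 1) = d (l + 1) * (1 + 2 * M l)\<close>.\<close>

lemma card_paths_bound:
  "real (card (paths d (Suc l) - {[]})) \<le> (\<Sum>k=1..l. 2 ^ (l - k) * (\<Prod>j=k..l. real (d j)))"
proof (induction l)
  case 0
  then show ?case by simp
next
  case (Suc l)
  let ?M = "\<Sum>k=1..l. 2 ^ (l - k) * (\<Prod>j=k..l. real (d j))"
  have "paths d (Suc (Suc l)) - {[]} \<subseteq> (\<Union>j<d (Suc l). (#) j ` paths d (Suc l))"
    by auto
  then have "card (paths d (Suc (Suc l)) - {[]}) \<le> card (\<Union>j<d (Suc l). (#) j ` paths d (Suc l))"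
    by (intro card_mono) (auto simp: finite_paths simp del: paths.simps)
  also have "\<dots> \<le> (\<Sum>j<d (Suc l). card ((#) j ` paths d (Suc l)))"
    by (rule card_UN_le) simp
  also have "\<dots> = d (Suc l) * (1 + card (paths d (Suc l) - {[]}))"
  proof -
    have "card (paths d (Suc l)) = 1 + card (paths d (Suc l) - {[]})"
      using card.remove[OF finite_paths Nil_in_paths, of "Suc l" d] by simp
    then show ?thesis by (simp add: card_image del: paths.simps)
  qed
  finally have "real (card (paths d (Suc (Suc l)) - {[]}))
      \<le> real (d (Suc l) * (1 + card (paths d (Suc l) - {[]})))"
    by (rule of_nat_mono)
  then have "real (card (paths d (Suc (Suc l)) - {[]}))
      \<le> real (d (Suc l)) * (1 + real (card (paths d (Suc l) - {[]})))"
    by (simp only: of_nat_mult of_nat_add of_nat_1)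
  also have "\<dots> \<le> real (d (Suc l)) * (1 + 2 * ?M)"
  proof -
    have "?M \<ge> 0" by (intro sum_nonneg mult_nonneg_nonneg prod_nonneg) auto
    then show ?thesis using Suc by (intro mult_left_mono) auto
  qed
  also have "\<dots> = (\<Sum>k=1..Suc l. 2 ^ (Suc l - k) * (\<Prod>j=k..Suc l. real (d j)))"
  proof -
    have "(\<Sum>k=1..l. 2 ^ (Suc l - k) * (\<Prod>j=k..Suc l. real (d j))) = 2 * real (d (Suc l)) * ?M"
      unfolding sum_distrib_left
      by (intro sum.cong) (auto simp: Suc_diff_le prod.nat_ivl_Suc')
    then show ?thesis by (simp add: distrib_left)
  qed
  finally show ?case .
qed

definition edge_sign :: "(nat \<times> nat \<times> nat) set \<Rightarrow> nat \<times> nat \<times> nat \<Rightarrow> real" where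
  "edge_sign s e = (if e \<in> s then 1 else - 1)"

text \<open>The output of the unrolled network at neuron \<open>i\<close> of layer \<open>l\<close>. The number \<open>t p\<close> is the
  value of the affine function at the node \<open>p\<close>, and the edge from neuron \<open>j\<close> of layer \<open>l\<close>
  to neuron \<open>i\<close> of layer \<open>l + 1\<close>, written \<open>(l + 1, i, j)\<close>, has weight 1 or -1 according to
  its membership in \<open>s\<close>.\<close>

fun tree_val :: "(nat \<Rightarrow> nat) \<Rightarrow> (nat \<times> nat \<times> nat) set \<Rightarrow> nat \<Rightarrow> nat \<Rightarrow> (nat list \<Rightarrow> real) \<Rightarrow> real" where
  "tree_val d s 0 i t = 0"
| "tree_val d s (Suc l) i t =
     max (t [] + (\<Sum>j<d l. edge_sign s (Suc l, i, j) * tree_val d s l j (\<lambda>p. t (j # p)))) 0"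

lemma tree_val_cong:
  "(\<And>p. p \<in> paths d l \<Longrightarrow> t p = t' p) \<Longrightarrow> tree_val d s l i t = tree_val d s l i t'"
proof (induction l arbitrary: i t t')
  case (Suc l)
  then have "tree_val d s l j (\<lambda>p. t (j # p)) = tree_val d s l j (\<lambda>p. t' (j # p))" if "j < d l" for j
    using that by (intro Suc.IH Suc.prems) auto
  moreover have "t [] = t' []" using Suc.prems by simp
  ultimately show ?case by simp
qed simp

lemma tree_val_scale:
  assumes "r \<ge> 0"
  shows "tree_val d s l i (\<lambda>p. r * t p) = r * tree_val d s l i t"
proof (induction l arbitrary: i t)
  case (Suc l)
  show ?case
    using assms by (simp add: Suc.IH max_mult_distrib_left distrib_left sum_distrib_left mult_ac)
qed simp

section \<open>Trees as differences of maxima\<close>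

definition graft :: "nat \<Rightarrow> (nat \<Rightarrow> nat list set set) \<Rightarrow> nat list set set" where
  "graft k \<B> = (\<lambda>B. \<Union>j<k. (#) j ` B j) ` {B. \<forall>j<k. B j \<in> \<B> j}"

text \<open>Write the branch \<open>j\<close> as \<open>g j - h j\<close> with maxima \<open>g j\<close> and \<open>h j\<close>, and sort the
  contributions by the sign of the edge into \<open>G - H\<close>; here \<open>G\<close> collects \<open>g j\<close> from
  positive and \<open>h j\<close> from negative edges, and \<open>H\<close> the others. Then
  \<open>max (t [] + G - H) 0 = max H (t [] + G) - H\<close>. Each member of these maxima is a sum of
  \<open>t\<close> over a set of nodes. The sets for the minuend are selected by \<open>b = True\<close>, those for
  the subtrahend by \<open>b = False\<close>.\<close>

fun pieces :: "(nat \<Rightarrow> nat) \<Rightarrow> (nat \<times> nat \<times> nat) set \<Rightarrow> nat \<Rightarrow> nat \<Rightarrow> bool \<Rightarrow> nat list set set" where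
  "pieces d s 0 i b = {{}}"
| "pieces d s (Suc l) i b =
     graft (d l) (\<lambda>j. pieces d s l j ((Suc l, i, j) \<notin> s)) \<union>
     (if b then insert [] ` graft (d l) (\<lambda>j. pieces d s l j ((Suc l, i, j) \<in> s)) else {})"

text \<open>The claim for the subtrahend, that the root is avoided, is what makes \<open>m\<close> half as large
  as \<open>n\<close>.\<close>

lemma pieces_subset:
  "A \<in> pieces d s l i b \<Longrightarrow> A \<subseteq> paths d l"
  "A \<in> pieces d s l i False \<Longrightarrow> A \<subseteq> paths d l - {[]}"
proof -
  have *: "A \<subseteq> (if b then paths d l else paths d l - {[]})" if "A \<in> pieces d s l i b" for A i b
    using that
  proof (induction l arbitrary: i b A)
    case (Suc l)
    have **: "A \<subseteq> (\<Union>j<d l. (#) j ` paths d l)" if A: "A \<in> graft (d l) (\<lambda>j. pieces d s l j (\<beta> j))" for A \<beta>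
    proof -
      obtain B where B: "A = (\<Union>j<d l. (#) j ` B j)" "\<And>j. j < d l \<Longrightarrow> B j \<in> pieces d s l j (\<beta> j)"
        using A unfolding graft_def by auto
      have "B j \<subseteq> paths d l" if "j < d l" for j
        using Suc.IH[OF B(2)[OF that]] by (auto split: if_splits)
      then show ?thesis unfolding B(1) by blast
    qed
    consider "A \<in> graft (d l) (\<lambda>j. pieces d s l j ((Suc l, i, j) \<notin> s))"
      | C where "b" "A = insert [] C" "C \<in> graft (d l) (\<lambda>j. pieces d s l j ((Suc l, i, j) \<in> s))"
      using Suc.prems by (auto split: if_splits)
    then show ?case
    proof cases
      case 1
      from **[OF this] show ?thesis by auto
    next
      case 2
      from **[OF 2(3)] 2(1,2) show ?thesis by auto
    qed
  qed auto
  show "A \<in> pieces d s l i b \<Longrightarrow> A \<subseteq> paths d l"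
    using *[of A i b] by (auto split: if_splits)
  show "A \<in> pieces d s l i False \<Longrightarrow> A \<subseteq> paths d l - {[]}"
    using *[of A i False] by simp
qed

lemma empty_in_graft: "(\<And>j. j < k \<Longrightarrow> {} \<in> \<B> j) \<Longrightarrow> {} \<in> graft k \<B>"
  unfolding graft_def by (rule image_eqI[of _ _ "\<lambda>_. {}"]) auto

lemma empty_in_pieces: "{} \<in> pieces d s l i b"
  by (induction l arbitrary: i b) (auto intro: empty_in_graft)

lemma single_branch_in_graft:
  assumes "\<And>j. j < k \<Longrightarrow> {} \<in> \<B> j" "j < k" "X \<in> \<B> j"
  shows "(#) j ` X \<in> graft k \<B>"
  unfolding graft_def using assms
  by (intro image_eqI[of _ _ "\<lambda>i. if i = j then X else {}"]) (auto split: if_splits)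

text \<open>The root is separated by \<open>{[]}\<close> and the empty set. A pair that separates a node of
  branch \<open>j\<close> inside this branch extends to the whole tree by empty choices in the other
  branches. If the edge to \<open>j\<close> is positive, the root joins both sets; otherwise the
  minuend of the branch is part of \<open>H\<close>, which is also a part of the minuend of the tree.\<close>

lemma pieces_separate_paths:
  "u \<in> paths d l \<Longrightarrow> \<exists>Y. Y \<in> pieces d s l i True \<and> insert u Y \<in> pieces d s l i True \<and> u \<notin> Y"
proof (induction l arbitrary: u i)
  case (Suc l)
  show ?case
  proof (cases u)
    case Nil
    have "{[]} \<in> pieces d s (Suc l) i True"
      by (auto intro!: image_eqI[of _ _ "{}"] empty_in_graft empty_in_pieces)
    then show ?thesis using Nil empty_in_pieces[of d s "Suc l" i True] by (intro exI[of _ "{}"]) auto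
  next
    case (Cons j v)
    then have jv: "j < d l" "v \<in> paths d l" using Suc.prems by auto
    obtain Y where Y: "Y \<in> pieces d s l j True" "insert v Y \<in> pieces d s l j True" "v \<notin> Y"
      using Suc.IH[OF jv(2)] by blast
    show ?thesis
    proof (cases "(Suc l, i, j) \<in> s")
      case True
      have "insert [] ((#) j ` X) \<in> pieces d s (Suc l) i True" if "X \<in> pieces d s l j True" for X
        using that True jv(1)
        by (auto intro!: imageI single_branch_in_graft empty_in_pieces)
      from this[OF Y(1)] this[OF Y(2)] Y(3) show ?thesis
        by (intro exI[of _ "insert [] ((#) j ` Y)"]) (auto simp: Cons insert_commute simp del: pieces.simps)
    next
      case False
      have "(#) j ` X \<in> pieces d s (Suc l) i True" if "X \<in> pieces d s l j True" for X
        using that False jv(1)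
        by (auto intro!: single_branch_in_graft empty_in_pieces)
      from this[OF Y(1)] this[OF Y(2)] Y(3) show ?thesis
        by (intro exI[of _ "(#) j ` Y"]) (auto simp: Cons simp del: pieces.simps)
    qed
  qed
qed auto

text \<open>As a relation, an attained maximum passes to unions and grafts by exhibiting the member
  at which it is attained.\<close>

definition is_max :: "('a \<Rightarrow> real) \<Rightarrow> 'a set \<Rightarrow> real \<Rightarrow> bool" where
  "is_max f S v \<longleftrightarrow> v \<in> f ` S \<and> (\<forall>A\<in>S. f A \<le> v)"

lemma is_max_Un: "is_max f S v \<Longrightarrow> is_max f S' v' \<Longrightarrow> is_max f (S \<union> S') (max v v')"
  unfolding is_max_def by (auto simp: max_def)

text \<open>The choices in different branches are independent and their nodes are disjoint, so the
  maximum of the sums is the sum of the maxima.\<close>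

lemma is_max_graft:
  assumes "\<And>j. j < k \<Longrightarrow> is_max (sum (\<lambda>p. t (j # p))) (\<B> j) (v j)"
    and "\<And>j X. j < k \<Longrightarrow> X \<in> \<B> j \<Longrightarrow> finite X"
  shows "is_max (sum t) (graft k \<B>) (\<Sum>j<k. v j)"
proof -
  have sum_eq: "sum t (\<Union>j<k. (#) j ` B j) = (\<Sum>j<k. sum (\<lambda>p. t (j # p)) (B j))"
    if "\<forall>j<k. B j \<in> \<B> j" for B
    using that assms(2) by (subst sum.UNION_disjoint) (auto simp: sum.reindex)
  have "\<forall>j<k. \<exists>X\<in>\<B> j. v j = sum (\<lambda>p. t (j # p)) X"
    using assms(1) unfolding is_max_def by auto
  then obtain B where B: "\<forall>j<k. B j \<in> \<B> j" "\<forall>j<k. v j = sum (\<lambda>p. t (j # p)) (B j)"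
    by metis
  have "(\<Sum>j<k. v j) = sum t (\<Union>j<k. (#) j ` B j)"
    using B by (simp add: sum_eq)
  moreover have "sum t A \<le> (\<Sum>j<k. v j)" if A: "A \<in> graft k \<B>" for A
  proof -
    obtain C where "A = (\<Union>j<k. (#) j ` C j)" "\<forall>j<k. C j \<in> \<B> j"
      using A unfolding graft_def by auto
    then show ?thesis using assms(1) by (auto simp: sum_eq is_max_def intro!: sum_mono)
  qed
  ultimately show ?thesis using B(1) unfolding is_max_def graft_def by auto
qed

lemma tree_val_eq_diff_max:
  "\<exists>g h. is_max (sum t) (pieces d s l i True) g \<and> is_max (sum t) (pieces d s l i False) h \<and>
         tree_val d s l i t = g - h"
proof (induction l arbitrary: i t)
  case 0
  show ?case by (auto simp: is_max_def)
next
  case (Suc l)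
  define P where "P j = ((Suc l, i, j) \<in> s)" for j
  define Q where "Q j g h \<longleftrightarrow> is_max (sum (\<lambda>p. t (j # p))) (pieces d s l j True) g \<and>
    is_max (sum (\<lambda>p. t (j # p))) (pieces d s l j False) h \<and>
    tree_val d s l j (\<lambda>p. t (j # p)) = g - h" for j g h
  have "\<forall>j. \<exists>g h. Q j g h" using Suc.IH unfolding Q_def by blast
  then obtain g h where gh: "\<And>j. Q j (g j) (h j)" by metis
  define v where "v j b = (if b then g j else h j)" for j b
  have v: "is_max (sum (\<lambda>p. t (j # p))) (pieces d s l j b) (v j b)" for j b
    using gh unfolding Q_def v_def by simp
  have val: "tree_val d s l j (\<lambda>p. t (j # p)) = v j True - v j False" for j
    using gh unfolding Q_def v_def by simp
  have fin: "finite X" if "X \<in> pieces d s l j b" for X j b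
    using pieces_subset(1)[OF that] finite_paths finite_subset by blast
  define G H where "G = (\<Sum>j<d l. v j (P j))" and "H = (\<Sum>j<d l. v j (\<not> P j))"
  have H: "is_max (sum t) (graft (d l) (\<lambda>j. pieces d s l j (\<not> P j))) H"
    unfolding H_def using v fin by (intro is_max_graft) auto
  have G: "is_max (sum t) (graft (d l) (\<lambda>j. pieces d s l j (P j))) G"
    unfolding G_def using v fin by (intro is_max_graft) auto
  have "sum t (insert [] A) = t [] + sum t A" if A: "A \<in> graft (d l) (\<lambda>j. pieces d s l j (P j))" for A
  proof -
    obtain B where B: "A = (\<Union>j<d l. (#) j ` B j)" "\<forall>j<d l. B j \<in> pieces d s l j (P j)"
      using A unfolding graft_def by auto
    then have "finite A" "[] \<notin> A" using fin by auto
    then show ?thesis by simp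
  qed
  then have G': "is_max (sum t) (insert [] ` graft (d l) (\<lambda>j. pieces d s l j (P j))) (t [] + G)"
    using G unfolding is_max_def by (auto simp: image_image)
  have "(\<Sum>j<d l. edge_sign s (Suc l, i, j) * tree_val d s l j (\<lambda>p. t (j # p))) = G - H"
    unfolding G_def H_def sum_subtractf[symmetric] val
    by (intro sum.cong) (auto simp: edge_sign_def P_def)
  then have "tree_val d s (Suc l) i t = max H (t [] + G) - H"
    by (simp add: max_def)
  moreover have "is_max (sum t) (pieces d s (Suc l) i True) (max H (t [] + G))"
    using is_max_Un[OF H G'] by (simp add: P_def)
  moreover have "is_max (sum t) (pieces d s (Suc l) i False) H"
    using H by (simp add: P_def)
  ultimately show ?case by blast
qed

section \<open>Networks and trees\<close>

text \<open>An affine function on \<open>\<real>\<^sup>n\<close> is stored as in a block of a parameter: entry 0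
  is the constant and the entry \<open>k + 1\<close> is the slope in direction \<open>k\<close>.\<close>

definition affine_val :: "nat \<Rightarrow> (nat \<Rightarrow> real) \<Rightarrow> real vec \<Rightarrow> real" where
  "affine_val n v x = v 0 + (\<Sum>k<n. v (Suc k) * x $ k)"

lemma affine_val_scale: "affine_val n (\<lambda>a. r * v a) x = r * affine_val n v x"
  by (simp add: affine_val_def distrib_left sum_distrib_left mult_ac)

lemma affine_val_sum: "affine_val n (\<lambda>a. \<Sum>u\<in>U. T u a) x = (\<Sum>u\<in>U. affine_val n (T u) x)"
  by (simp add: affine_val_def sum.distrib sum_distrib_right sum.swap[of _ _ U])

lemma affine_val_cong: "(\<And>a. a \<le> n \<Longrightarrow> v a = w a) \<Longrightarrow> affine_val n v x = affine_val n w x"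
  by (simp add: affine_val_def)

text \<open>Each neuron \<open>(l, i)\<close> has a family \<open>t l i\<close> of node values. If the family of a neuron
  restricts on branch \<open>j\<close> to \<open>r\<close> times the family of neuron \<open>j\<close>, then positive homogeneity
  makes the branch contribute \<open>r\<close> times the output of neuron \<open>j\<close>, as in a network whose
  weight has absolute value \<open>r\<close>. This serves both directions: from weights to trees and
  from trees to weights.\<close>

lemma relu_net_eq_tree_val:
  assumes dims: "\<forall>l\<in>{1..L}. W l \<in> carrier_mat (d l) (d (l - 1)) \<and> c l \<in> carrier_vec (d l)"
    and x: "x \<in> carrier_vec (d 0)"
    and first: "\<And>i. i < d 1 \<Longrightarrow> t 1 i [] = c 1 $ i + (\<Sum>k<d 0. W 1 $$ (i, k) * x $ k)"
    and bias: "\<And>l i. 1 \<le> l \<Longrightarrow> l < L \<Longrightarrow> i < d (Suc l) \<Longrightarrow> t (Suc l) i [] = c (Suc l) $ i"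
    and weight: "\<And>l i j. 1 \<le> l \<Longrightarrow> l < L \<Longrightarrow> i < d (Suc l) \<Longrightarrow> j < d l \<Longrightarrow>
      W (Suc l) $$ (i, j) = edge_sign s (Suc l, i, j) * r l i j \<and> r l i j \<ge> 0 \<and>
      (\<forall>q\<in>paths d l. t (Suc l) i (j # q) = r l i j * t l j q)"
    and "1 \<le> l" "l \<le> L"
  shows "relu_net W c l x \<in> carrier_vec (d l) \<and>
         (\<forall>i<d l. relu_net W c l x $ i = tree_val d s l i (t l i))"
  using \<open>1 \<le> l\<close> \<open>l \<le> L\<close>
proof (induction l)
  case (Suc l)
  have Wc: "W (Suc l) \<in> carrier_mat (d (Suc l)) (d l)" "c (Suc l) \<in> carrier_vec (d (Suc l))"
    using dims Suc.prems by (auto dest: bspec[of _ _ "Suc l"])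
  have prev: "relu_net W c l x \<in> carrier_vec (d l)"
    using Suc x by (cases l) auto
  have step: "relu_net W c (Suc l) x $ i
      = max ((\<Sum>j<d l. W (Suc l) $$ (i, j) * relu_net W c l x $ j) + c (Suc l) $ i) 0"
    if "i < d (Suc l)" for i
    using that Wc prev by (simp add: relu_def scalar_prod_def atLeast0LessThan)
  have "relu_net W c (Suc l) x $ i = tree_val d s (Suc l) i (t (Suc l) i)" if i: "i < d (Suc l)" for i
  proof (cases l)
    case 0
    then show ?thesis using i first[of i] step[OF i] by (simp add: add_ac)
  next
    case (Suc l')
    then have l: "1 \<le> l" "l < L" using Suc.prems by auto
    have "W (Suc l) $$ (i, j) * relu_net W c l x $ j
       = edge_sign s (Suc l, i, j) * tree_val d s l j (\<lambda>p. t (Suc l) i (j # p))" if j: "j < d l" for j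
    proof -
      note w = weight[OF l i j]
      have "tree_val d s l j (\<lambda>p. t (Suc l) i (j # p)) = tree_val d s l j (\<lambda>p. r l i j * t l j p)"
        using w by (intro tree_val_cong) auto
      also have "\<dots> = r l i j * relu_net W c l x $ j"
        using w Suc.IH l j by (simp add: tree_val_scale)
      finally show ?thesis using w by simp
    qed
    then show ?thesis using i bias[OF l i] by (simp add: step add_ac del: relu_net.simps)
  qed
  moreover have "relu_net W c (Suc l) x \<in> carrier_vec (d (Suc l))"
    using add_carrier_vec[OF mult_mat_vec_carrier[OF Wc(1) prev] Wc(2)] by (simp add: relu_def)
  ultimately show ?case by blast
qed simp

text \<open>A matrix with vanishing two by two minors has rank at most one, so all rows are
  multiples of any nonzero row; columns of constant sign make the factors nonnegative. If
  all rows vanish, the zero row serves. Demanding \<open>z\<close> among the rows, rather than some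
  common direction, lets conditions on the rows pass to \<open>z\<close>.\<close>

lemma nonneg_parallel_representative:
  fixes V :: "'p \<Rightarrow> 'i \<Rightarrow> real"
  assumes minors: "\<And>p p' i i'. p \<in> P \<Longrightarrow> p' \<in> P \<Longrightarrow> i \<in> I \<Longrightarrow> i' \<in> I \<Longrightarrow> V p i * V p' i' = V p i' * V p' i"
    and same_sign: "\<And>p p' i. p \<in> P \<Longrightarrow> p' \<in> P \<Longrightarrow> i \<in> I \<Longrightarrow> V p i * V p' i \<ge> 0"
  shows "\<exists>z. (z \<in> V ` P \<or> z = (\<lambda>_. 0)) \<and> (\<forall>p\<in>P. \<exists>r\<ge>0. \<forall>i\<in>I. V p i = r * z i)"
proof (cases "\<exists>p\<in>P. \<exists>i\<in>I. V p i \<noteq> 0")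
  case True
  then obtain p0 i0 where *: "p0 \<in> P" "i0 \<in> I" "V p0 i0 \<noteq> 0" by blast
  have "\<exists>r\<ge>0. \<forall>i\<in>I. V p i = r * V p0 i" if p: "p \<in> P" for p
  proof (intro exI conjI ballI)
    show "V p i0 / V p0 i0 \<ge> 0"
      using same_sign[OF p *(1,2)] by (simp add: zero_le_divide_iff zero_le_mult_iff)
    fix i assume "i \<in> I"
    then show "V p i = V p i0 / V p0 i0 * V p0 i"
      using minors[OF p *(1) _ *(2)] *(3) by (simp add: field_simps)
  qed
  then show ?thesis using *(1) by blast
next
  case False
  then show ?thesis by (intro exI[of _ "\<lambda>_. 0"]) auto
qed

text \<open>The node \<open>p\<close> is a copy of the neuron \<open>last (0 # p)\<close> of layer \<open>L - length p\<close>; the prefix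
  0 stands for the output neuron, at which every walk starts. The conditions say that \<open>T\<close>
  has no slopes outside the first layer and that the subtrees at copies of one neuron are
  nonnegatively proportional.\<close>

definition realizable :: "(nat \<Rightarrow> nat) \<Rightarrow> nat \<Rightarrow> (nat list \<Rightarrow> nat \<Rightarrow> real) \<Rightarrow> bool" where
  "realizable d L T \<longleftrightarrow>
    (\<forall>u\<in>paths d L. \<forall>k<d 0. Suc (length u) < L \<longrightarrow> T u (Suc k) = 0) \<and>
    (\<forall>p\<in>paths d L. \<forall>p'\<in>paths d L. length p = length p' \<longrightarrow> last (0 # p) = last (0 # p') \<longrightarrow>
      (\<forall>q\<in>paths d (L - length p). \<forall>q'\<in>paths d (L - length p). \<forall>a\<le>d 0. \<forall>a'\<le>d 0.
        T (p @ q) a * T (p' @ q') a' = T (p @ q') a' * T (p' @ q) a) \<and>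
      (\<forall>q\<in>paths d (L - length p). \<forall>a\<le>d 0. T (p @ q) a * T (p' @ q) a \<ge> 0))"

text \<open>For every neuron choose one copy whose subtree represents all its copies. The branch \<open>j\<close>
  of the representative of a neuron is a subtree at a copy of neuron \<open>j\<close> one layer below,
  so it is \<open>r\<close> times the representative of \<open>j\<close>, and \<open>r\<close> with the sign of the edge is a
  valid weight. The output neuron has only one copy, hence the network computes the tree
  of \<open>T\<close> itself.\<close>

lemma realizable_imp_net:
  assumes R: "realizable d L T" and L: "L \<ge> 1" and dL: "d L = 1"
  obtains W c where "\<forall>l\<in>{1..L}. W l \<in> carrier_mat (d l) (d (l - 1)) \<and> c l \<in> carrier_vec (d l)"
    and "\<And>x. x \<in> carrier_vec (d 0) \<Longrightarrow>
      relu_net W c L x $ 0 = tree_val d s L 0 (\<lambda>u. affine_val (d 0) (T u) x)"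
proof -
  (* P l i are the copies of neuron i of layer l; V p is the subtree at p as a vector. *)
  define P where "P l i = {p \<in> paths d L. length p = L - l \<and> last (0 # p) = i}" for l i
  define V where "V p = (\<lambda>(q, a). T (p @ q) a)" for p
  define I where "I l = paths d l \<times> {..d 0}" for l
  have "\<exists>z. (z \<in> V ` P l i \<or> z = (\<lambda>_. 0)) \<and> (\<forall>p\<in>P l i. \<exists>r\<ge>0. \<forall>k\<in>I l. V p k = r * z k)"
    if l: "l \<le> L" for l i
  proof (rule nonneg_parallel_representative)
    fix p p' k k' assume "p \<in> P l i" "p' \<in> P l i" "k \<in> I l" "k' \<in> I l"
    moreover obtain q a q' a' where "k = (q, a)" "k' = (q', a')" by (metis surj_pair)
    ultimately show "V p k * V p' k' = V p k' * V p' k"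
      using R l unfolding realizable_def P_def V_def I_def by auto
  next
    fix p p' k assume "p \<in> P l i" "p' \<in> P l i" "k \<in> I l"
    moreover obtain q a where "k = (q, a)" by (metis surj_pair)
    ultimately show "V p k * V p' k \<ge> 0"
      using R l unfolding realizable_def P_def V_def I_def by auto
  qed
  then obtain z where z: "\<And>l i. l \<le> L \<Longrightarrow> z l i \<in> V ` P l i \<or> z l i = (\<lambda>_. 0)"
    and zr: "\<And>l i p. l \<le> L \<Longrightarrow> p \<in> P l i \<Longrightarrow> \<exists>r\<ge>0. \<forall>k\<in>I l. V p k = r * z l i k"
    by metis
  define scaled where "scaled l i j \<rho> \<longleftrightarrow> \<rho> \<ge> 0 \<and>
    (\<forall>q\<in>paths d l. \<forall>a\<le>d 0. z (Suc l) i (j # q, a) = \<rho> * z l j (q, a))" for l i j \<rho>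
  have "\<exists>\<rho>. scaled l i j \<rho>"
    if l: "1 \<le> l" "l < L" and j: "j < d l" for l i j
  proof -
    consider p where "p \<in> P (Suc l) i" "z (Suc l) i = V p" | "z (Suc l) i = (\<lambda>_. 0)"
      using z[of "Suc l" i] l by auto
    then show ?thesis
    proof cases
      case 1
      then have p: "p \<in> paths d L" "length p = L - Suc l" by (auto simp: P_def)
      then have "L - length p = Suc l" using l by simp
      then have "p @ [j] \<in> paths d L"
        using append_in_paths[OF p(1), of "[j]"] j Nil_in_paths[OF l(1)] by auto
      then have "p @ [j] \<in> P l j" using p l by (auto simp: P_def)
      from zr[OF _ this] l obtain r where "r \<ge> 0" "\<forall>k\<in>I l. V (p @ [j]) k = r * z l j k" by auto
      then show ?thesis using 1 by (intro exI[of _ r]) (auto simp: scaled_def I_def V_def)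
    next
      case 2
      then show ?thesis by (intro exI[of _ 0]) (simp add: scaled_def)
    qed
  qed
  then have "\<forall>l i j. \<exists>\<rho>. 1 \<le> l \<longrightarrow> l < L \<longrightarrow> j < d l \<longrightarrow> scaled l i j \<rho>" by blast
  then obtain r where "\<And>l i j. 1 \<le> l \<Longrightarrow> l < L \<Longrightarrow> j < d l \<Longrightarrow> scaled l i j (r l i j)" by metis
  then have r: "r l i j \<ge> 0 \<and>
      (\<forall>q\<in>paths d l. \<forall>a\<le>d 0. z (Suc l) i (j # q, a) = r l i j * z l j (q, a))"
    if "1 \<le> l" "l < L" "j < d l" for l i j
    using that unfolding scaled_def by blast
  define c where "c l = vec (d l) (\<lambda>i. z l i ([], 0))" for l
  define W where "W l = mat (d l) (d (l - 1)) (\<lambda>(i, j).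
    if l = 1 then z 1 i ([], Suc j) else edge_sign s (l, i, j) * r (l - 1) i j)" for l
  have dims: "\<forall>l\<in>{1..L}. W l \<in> carrier_mat (d l) (d (l - 1)) \<and> c l \<in> carrier_vec (d l)"
    by (auto simp: W_def c_def)
  have slope0: "z l i ([], Suc k) = 0" if "1 < l" "l \<le> L" "k < d 0" for l i k
    using z[of l i] R that by (auto simp: P_def V_def realizable_def)
  have root: "z L 0 (q, a) = T q a" if "q \<in> paths d L" "a \<le> d 0" for q a
  proof -
    have "[] \<in> P L 0" using L by (auto simp: P_def Nil_in_paths)
    from zr[OF _ this] obtain \<rho> where "\<forall>k\<in>I L. V [] k = \<rho> * z L 0 k" by auto
    then have "T q a = \<rho> * z L 0 (q, a)" using that by (auto simp: I_def V_def)
    moreover have "z L 0 \<in> V ` {[]} \<or> z L 0 = (\<lambda>_. 0)"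
      using z[of L 0] by (auto simp: P_def)
    ultimately show ?thesis by (auto simp: V_def)
  qed
  have "relu_net W c L x $ 0 = tree_val d s L 0 (\<lambda>u. affine_val (d 0) (T u) x)"
    if x: "x \<in> carrier_vec (d 0)" for x
  proof -
    define t where "t l i q = affine_val (d 0) (\<lambda>a. z l i (q, a)) x" for l i q
    have "relu_net W c L x \<in> carrier_vec (d L) \<and>
         (\<forall>i<d L. relu_net W c L x $ i = tree_val d s L i (t L i))"
    proof (rule relu_net_eq_tree_val[OF dims x, where r = r])
      fix i assume "i < d 1"
      then show "t 1 i [] = c 1 $ i + (\<Sum>k<d 0. W 1 $$ (i, k) * x $ k)"
        by (simp add: t_def affine_val_def c_def W_def)
    next
      fix l i assume "1 \<le> l" "l < L" "i < d (Suc l)"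
      then show "t (Suc l) i [] = c (Suc l) $ i"
        by (simp add: t_def affine_val_def c_def slope0)
    next
      fix l i j assume *: "1 \<le> l" "l < L" "i < d (Suc l)" "j < d l"
      have "t (Suc l) i (j # q) = r l i j * t l j q" if "q \<in> paths d l" for q
        unfolding t_def affine_val_scale[symmetric] using that r[OF *(1,2,4)] by (intro affine_val_cong) auto
      then show "W (Suc l) $$ (i, j) = edge_sign s (Suc l, i, j) * r l i j \<and> r l i j \<ge> 0 \<and>
        (\<forall>q\<in>paths d l. t (Suc l) i (j # q) = r l i j * t l j q)"
        using * r[OF *(1,2,4)] by (simp add: W_def)
    qed (use L in auto)
    then have "relu_net W c L x $ 0 = tree_val d s L 0 (t L 0)" using dL by simp
    also have "\<dots> = tree_val d s L 0 (\<lambda>u. affine_val (d 0) (T u) x)"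
      unfolding t_def by (intro tree_val_cong affine_val_cong root)
    finally show ?thesis .
  qed
  with dims show thesis by (rule that)
qed

definition edges :: "(nat \<Rightarrow> nat) \<Rightarrow> nat \<Rightarrow> (nat \<times> nat \<times> nat) set" where
  "edges d L = (SIGMA l:{1..L}. {..<d l} \<times> {..<d (l - 1)})"

text \<open>The affine function at a node is that of the neuron reached, multiplied by the absolute
  values of all weights along the walk.\<close>

fun unrolled :: "(nat \<Rightarrow> real mat) \<Rightarrow> (nat \<Rightarrow> real vec) \<Rightarrow> nat \<Rightarrow> nat \<Rightarrow> nat list \<Rightarrow> nat \<Rightarrow> real" where
  "unrolled W c l i [] a =
     (if a = 0 then c l $ i else if l = 1 then W 1 $$ (i, a - 1) else 0)"
| "unrolled W c l i (j # q) a = \<bar>W l $$ (i, j)\<bar> * unrolled W c (l - 1) j q a"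

text \<open>The subtree at \<open>p\<close> depends on the neuron that \<open>p\<close> reaches, apart from the nonnegative
  product of absolute weights along \<open>p\<close>.\<close>

lemma unrolled_append:
  "\<exists>r\<ge>0. \<forall>q a. unrolled W c l i (p @ q) a = r * unrolled W c (l - length p) (last (i # p)) q a"
proof (induction p arbitrary: l i)
  case Nil
  show ?case by (intro exI[of _ 1]) simp
next
  case (Cons j p)
  obtain r where r: "r \<ge> 0"
    "\<forall>q a. unrolled W c (l - 1) j (p @ q) a = r * unrolled W c (l - 1 - length p) (last (j # p)) q a"
    using Cons.IH[of "l - 1" j] by blast
  then show ?case by (intro exI[of _ "\<bar>W l $$ (i, j)\<bar> * r"]) (auto simp del: last.simps simp: last_ConsR)
qed

lemma unrolled_realizable: "realizable d L (unrolled W c L 0)"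
proof -
  let ?T = "unrolled W c L 0"
  have "?T u (Suc k) = 0" if "Suc (length u) < L" for u k
  proof -
    obtain r where "\<forall>q a. ?T (u @ q) a = r * unrolled W c (L - length u) (last (0 # u)) q a"
      using unrolled_append by blast
    from this[rule_format, of "[]" "Suc k"] show ?thesis using that by simp
  qed
  moreover
  have "(\<forall>q q' a a'. ?T (p @ q) a * ?T (p' @ q') a' = ?T (p @ q') a' * ?T (p' @ q) a) \<and>
      (\<forall>q a. ?T (p @ q) a * ?T (p' @ q) a \<ge> 0)"
    if same: "length p = length p'" "last (0 # p) = last (0 # p')" for p p'
  proof -
    obtain r where r: "r \<ge> 0"
      "\<forall>q a. ?T (p @ q) a = r * unrolled W c (L - length p) (last (0 # p)) q a"
      using unrolled_append by blast
    obtain r' where r': "r' \<ge> 0"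
      "\<forall>q a. ?T (p' @ q) a = r' * unrolled W c (L - length p) (last (0 # p)) q a"
      using unrolled_append same by metis
    have "r * y * (r' * y) \<ge> 0" "r * y * (r' * y') = r * y' * (r' * y)" for y y'
      using mult_nonneg_nonneg[OF mult_nonneg_nonneg[OF r(1) r'(1)] zero_le_square[of y]]
      by (simp_all add: mult_ac)
    then show ?thesis unfolding r(2)[rule_format] r'(2)[rule_format] by blast
  qed
  ultimately show ?thesis unfolding realizable_def by blast
qed

lemma net_eq_unrolled_tree:
  assumes dims: "\<forall>l\<in>{1..L}. W l \<in> carrier_mat (d l) (d (l - 1)) \<and> c l \<in> carrier_vec (d l)"
    and L: "L \<ge> 1" and dL: "d L = 1" and x: "x \<in> carrier_vec (d 0)"
  shows "relu_net W c L x $ 0 = tree_val d {(l, i, j) \<in> edges d L. W l $$ (i, j) \<ge> 0} L 0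
           (\<lambda>u. affine_val (d 0) (unrolled W c L 0 u) x)"
    (is "_ = tree_val d ?s L 0 _")
proof -
  define t where "t l i = (\<lambda>q. affine_val (d 0) (unrolled W c l i q) x)" for l i
  have "relu_net W c L x \<in> carrier_vec (d L) \<and>
       (\<forall>i<d L. relu_net W c L x $ i = tree_val d ?s L i (t L i))"
  proof (rule relu_net_eq_tree_val[OF dims x, where r = "\<lambda>l i j. \<bar>W (Suc l) $$ (i, j)\<bar>"])
    fix l i j assume *: "1 \<le> l" "l < L" "i < d (Suc l)" "j < d l"
    have "t (Suc l) i (j # q) = \<bar>W (Suc l) $$ (i, j)\<bar> * t l j q" for q
      unfolding t_def affine_val_scale[symmetric] by (intro affine_val_cong) simp
    then show "W (Suc l) $$ (i, j) = edge_sign ?s (Suc l, i, j) * \<bar>W (Suc l) $$ (i, j)\<bar> \<and>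
        \<bar>W (Suc l) $$ (i, j)\<bar> \<ge> 0 \<and>
        (\<forall>q\<in>paths d l. t (Suc l) i (j # q) = \<bar>W (Suc l) $$ (i, j)\<bar> * t l j q)"
      using * by (auto simp: edge_sign_def edges_def)
  qed (use L in \<open>auto simp: t_def affine_val_def\<close>)
  then show ?thesis using dL by (simp add: t_def)
qed


text \<open>The functions of the networks whose weights beyond the first layer have the signs given
  by \<open>s\<close> (a zero weight has both signs), described by the trees instead of the weights.\<close>

definition tree_funs :: "(nat \<Rightarrow> nat) \<Rightarrow> (nat \<times> nat \<times> nat) set \<Rightarrow> nat \<Rightarrow> (real vec \<Rightarrow> real) set" where
  "tree_funs d s L = {\<lambda>x\<in>carrier_vec (d 0). tree_val d s L 0 (\<lambda>u. affine_val (d 0) (T u) x) | T.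
     realizable d L T}"

lemma ReLU_scalar_eq_tree_funs:
  assumes L: "L \<ge> 1" and dL: "d L = 1"
  shows "ReLU_scalar d L = (\<Union>s\<in>Pow (edges d L). tree_funs d s L)"
proof (intro subset_antisym subsetI)
  fix f assume "f \<in> ReLU_scalar d L"
  then obtain W c where dims: "\<forall>l\<in>{1..L}. W l \<in> carrier_mat (d l) (d (l - 1)) \<and> c l \<in> carrier_vec (d l)"
    and f: "f = (\<lambda>x\<in>carrier_vec (d 0). restrict (relu_net W c L) (carrier_vec (d 0)) x $ 0)"
    unfolding ReLU_scalar_def ReLU_def by blast
  define s where "s = {(l, i, j) \<in> edges d L. W l $$ (i, j) \<ge> 0}"
  have "f = (\<lambda>x\<in>carrier_vec (d 0). tree_val d s L 0 (\<lambda>u. affine_val (d 0) (unrolled W c L 0 u) x))"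
    unfolding f s_def using net_eq_unrolled_tree[OF dims L dL] by (intro restrict_ext) simp
  then have "f \<in> tree_funs d s L"
    unfolding tree_funs_def using unrolled_realizable by blast
  moreover have "s \<in> Pow (edges d L)" unfolding s_def by blast
  ultimately show "f \<in> (\<Union>s\<in>Pow (edges d L). tree_funs d s L)" by blast
next
  fix f assume "f \<in> (\<Union>s\<in>Pow (edges d L). tree_funs d s L)"
  then obtain s T where R: "realizable d L T"
    and f: "f = (\<lambda>x\<in>carrier_vec (d 0). tree_val d s L 0 (\<lambda>u. affine_val (d 0) (T u) x))"
    unfolding tree_funs_def by blast
  obtain W c where dims: "\<forall>l\<in>{1..L}. W l \<in> carrier_mat (d l) (d (l - 1)) \<and> c l \<in> carrier_vec (d l)"
    and val: "\<And>x. x \<in> carrier_vec (d 0) \<Longrightarrow>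
      relu_net W c L x $ 0 = tree_val d s L 0 (\<lambda>u. affine_val (d 0) (T u) x)"
    using realizable_imp_net[OF R L dL] by blast
  have "f = (\<lambda>x\<in>carrier_vec (d 0). restrict (relu_net W c L) (carrier_vec (d 0)) x $ 0)"
    unfolding f using val by (intro restrict_ext) simp
  then show "f \<in> ReLU_scalar d L"
    unfolding ReLU_scalar_def ReLU_def using dims by blast
qed

section \<open>The semialgebraic set of parameters\<close>

lemma polynomial_system_realizable:
  assumes lin: "\<And>u a. u \<in> paths d L \<Longrightarrow> a \<le> d 0 \<Longrightarrow> linear_form N (\<lambda>\<theta>. T \<theta> u a)" and D: "D \<ge> 2"
  shows "polynomial_system N D (\<lambda>\<theta>. realizable d L (T \<theta>))"
  unfolding realizable_def
  using D
  by (intro polynomial_system_conj polynomial_system_ball polynomial_system_all_less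
      polynomial_system_all_le polynomial_system_imp polynomial_system_eq_linear
      polynomial_system_eq_mult_linear polynomial_system_nonneg polynomial_fun_mult_linear
      lin linear_form_zero finite_paths) (auto simp: append_in_paths)

text \<open>Repetitions pad the maxima to the prescribed number of blocks, which has to be the same
  for all sign patterns.\<close>

lemma ex_enumeration_with_repetition:
  assumes "finite A" "A \<noteq> {}" "card A \<le> n"
  shows "\<exists>f. f ` {..<n::nat} = A"
proof -
  obtain h where "bij_betw h {0..<card A} A" using ex_bij_betw_nat_finite[OF assms(1)] by blast
  then have h: "h ` {..<card A} = A" by (simp add: bij_betw_def atLeast0LessThan)
  obtain a where a: "a \<in> A" using assms(2) by blast
  let ?f = "\<lambda>i. if i < card A then h i else a"
  have "A = ?f ` {..<card A}" using h by (auto cong: image_cong_simp)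
  also have "\<dots> \<subseteq> ?f ` {..<n}" using assms(3) by (intro image_mono) auto
  finally have "A \<subseteq> ?f ` {..<n}" .
  moreover have "?f ` {..<n} \<subseteq> A" using h a by auto
  ultimately show ?thesis by blast
qed

lemma Max_eq_is_max: "is_max f (\<alpha> ` I) v \<Longrightarrow> finite I \<Longrightarrow> (MAX i\<in>I. f (\<alpha> i)) = v"
  unfolding is_max_def by (intro Max_eqI) auto

lemma trop_rat_eq_tree_val:
  assumes g: "\<alpha> ` {..<n} = pieces d s L i True"
    and h: "(\<lambda>j. \<alpha> (n + j)) ` {..<m} = pieces d s L i False"
    and \<theta>: "\<forall>k<n+m. \<forall>a\<le>d 0. \<theta> $ (k * (d 0 + 1) + a) = (\<Sum>u\<in>\<alpha> k. T u a)"
    and x: "x \<in> carrier_vec (d 0)"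
  shows "trop_rat (d 0) n m \<theta> x = tree_val d s L i (\<lambda>u. affine_val (d 0) (T u) x)"
proof -
  let ?t = "\<lambda>u. affine_val (d 0) (T u) x"
  have block: "block_affine (d 0) \<theta> k x = sum ?t (\<alpha> k)" if k: "k < n + m" for k
  proof -
    have "block_affine (d 0) \<theta> k x = affine_val (d 0) (\<lambda>a. \<theta> $ (k * (d 0 + 1) + a)) x"
      using x by (simp add: block_affine_def block_const_def block_slope_def scalar_prod_def
          affine_val_def atLeast0LessThan)
    also have "\<dots> = affine_val (d 0) (\<lambda>a. \<Sum>u\<in>\<alpha> k. T u a) x"
      using \<theta> k by (intro affine_val_cong) blast
    finally show ?thesis by (simp only: affine_val_sum)
  qed
  obtain v w where vw: "is_max (sum ?t) (pieces d s L i True) v" "is_max (sum ?t) (pieces d s L i False) w"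
    and eq: "tree_val d s L i ?t = v - w"
    using tree_val_eq_diff_max by blast
  have "(MAX k\<in>{..<n}. block_affine (d 0) \<theta> k x) = (MAX k\<in>{..<n}. sum ?t (\<alpha> k))"
    using block by (intro arg_cong[where f = Max] image_cong) auto
  moreover have "\<dots> = v"
    using vw(1) unfolding g[symmetric] by (rule Max_eq_is_max) simp
  moreover have "(MAX j\<in>{..<m}. block_affine (d 0) \<theta> (n + j) x) = (MAX j\<in>{..<m}. sum ?t (\<alpha> (n + j)))"
    using block by (intro arg_cong[where f = Max] image_cong) auto
  moreover have "\<dots> = w"
    using vw(2) unfolding h[symmetric] by (rule Max_eq_is_max) simp
  ultimately show ?thesis using x eq by (simp add: trop_rat_def)
qed

text \<open>The parameters built from families \<open>T\<close> by summing over sets of nodes are an injective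
  linear image of these families, and a left inverse takes a difference of two blocks for
  each node. Substituting this left inverse for \<open>T\<close> removes the quantifier over \<open>T\<close>: the
  blocks have to be the sums formed from the reconstructed \<open>T\<close>, which is linear, and the
  reconstructed \<open>T\<close> has to be realizable, which is quadratic.\<close>

lemma tree_funs_semialgebraic:
  assumes n: "n \<ge> 2 ^ card (paths d L)" and m: "m \<ge> 2 ^ card (paths d L - {[]})" and D: "D \<ge> 2"
  shows "\<exists>S \<subseteq> Theta (d 0) n m. semialgebraic_deg_le ((n + m) * (d 0 + 1)) D S \<and>
    {trop_rat (d 0) n m \<theta> | \<theta>. \<theta> \<in> S} = tree_funs d s L"
proof -
  let ?N = "(n + m) * (d 0 + 1)"
  have fin: "finite A" if "A \<in> pieces d s L 0 b" for A b
    using pieces_subset(1)[OF that] finite_paths finite_subset by blast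
  have sub: "pieces d s L 0 b \<subseteq> Pow (paths d L)" "pieces d s L 0 False \<subseteq> Pow (paths d L - {[]})" for b
    using pieces_subset(1)[of _ d s L 0 b] pieces_subset(2)[of _ d s L 0] by blast+
  have "card (pieces d s L 0 True) \<le> n"
    using card_mono[OF _ sub(1)[of True]] n by (simp add: finite_paths card_Pow)
  moreover have "card (pieces d s L 0 False) \<le> m"
    using card_mono[OF _ sub(2)] m by (simp add: finite_paths card_Pow)
  moreover have "finite (pieces d s L 0 b)" for b
    using sub(1)[of b] by (rule finite_subset) (simp add: finite_paths)
  ultimately obtain \<alpha>g \<alpha>h where \<alpha>: "\<alpha>g ` {..<n} = pieces d s L 0 True" "\<alpha>h ` {..<m} = pieces d s L 0 False"
    using ex_enumeration_with_repetition empty_in_pieces by (metis empty_iff)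
  (* The blocks up to n - 1 form the minuend and the last m blocks the subtrahend. *)
  define \<alpha> where "\<alpha> k = (if k < n then \<alpha>g k else \<alpha>h (k - n))" for k
  have g: "\<alpha> ` {..<n} = pieces d s L 0 True" and h: "(\<lambda>j. \<alpha> (n + j)) ` {..<m} = pieces d s L 0 False"
    using \<alpha> by (auto simp: \<alpha>_def)
  have \<alpha>_piece: "\<exists>b. \<alpha> k \<in> pieces d s L 0 b" if k: "k < n + m" for k
  proof (cases "k < n")
    case True
    then show ?thesis using g by blast
  next
    case False
    then have "k - n \<in> {..<m}" "k = n + (k - n)" using k by auto
    then show ?thesis using h by (metis imageI)
  qed
  have "\<exists>p q. p < n \<and> q < n \<and> \<alpha> p = insert u (\<alpha> q) \<and> u \<notin> \<alpha> q" if u: "u \<in> paths d L" for u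
  proof -
    obtain Y where Y: "Y \<in> \<alpha> ` {..<n}" "insert u Y \<in> \<alpha> ` {..<n}" "u \<notin> Y"
      using pieces_separate_paths[OF u, of s 0] unfolding g by blast
    then obtain p q where "p < n" "q < n" "Y = \<alpha> q" "insert u Y = \<alpha> p" by auto
    then show ?thesis using Y(3) by (intro exI[of _ p] exI[of _ q]) simp
  qed
  then obtain p q where pq: "\<And>u. u \<in> paths d L \<Longrightarrow>
      p u < n \<and> q u < n \<and> \<alpha> (p u) = insert u (\<alpha> (q u)) \<and> u \<notin> \<alpha> (q u)"
    by metis
  (* The left inverse: the sets at the blocks p u and q u differ by the node u. *)
  define T where "T \<theta> u a = \<theta> $ (p u * (d 0 + 1) + a) - \<theta> $ (q u * (d 0 + 1) + a)"
    for \<theta> :: "real vec" and u a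
  have index: "k * (d 0 + 1) + a < ?N" if "k < n + m" "a \<le> d 0" for k a
  proof -
    have "k * (d 0 + 1) + a < (k + 1) * (d 0 + 1)" using that(2) by simp
    also have "\<dots> \<le> ?N" using that(1) by (intro mult_right_mono) auto
    finally show ?thesis .
  qed
  have lin: "linear_form ?N (\<lambda>\<theta>. T \<theta> u a)" if "u \<in> paths d L" "a \<le> d 0" for u a
    unfolding T_def using pq[OF that(1)] that(2)
    by (intro linear_form_diff linear_form_coordinate index) auto
  define \<Phi> where "\<Phi> \<theta> \<longleftrightarrow>
    (\<forall>k<n+m. \<forall>a\<le>d 0. \<theta> $ (k * (d 0 + 1) + a) = (\<Sum>u\<in>\<alpha> k. T \<theta> u a)) \<and> realizable d L (T \<theta>)" for \<theta>
  have "polynomial_system ?N D (\<lambda>\<theta>. \<Phi> \<theta>)"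
    unfolding \<Phi>_def
  proof (intro polynomial_system_conj polynomial_system_all_less polynomial_system_all_le
      polynomial_system_eq_linear linear_form_coordinate linear_form_sum index)
    fix k a u assume "k < n + m" "a \<le> d 0" "u \<in> \<alpha> k"
    then show "linear_form ?N (\<lambda>\<theta>. T \<theta> u a)"
      using \<alpha>_piece pieces_subset(1) by (intro lin) blast+
  next
    show "polynomial_system ?N D (\<lambda>\<theta>. realizable d L (T \<theta>))"
      using lin D by (rule polynomial_system_realizable)
  qed (use D in auto)
  then have semi: "semialgebraic_deg_le ?N D {\<theta> \<in> carrier_vec ?N. \<Phi> \<theta>}"
    by (rule semialgebraic_polynomial_system)
  have val: "trop_rat (d 0) n m \<theta>
      = (\<lambda>x\<in>carrier_vec (d 0). tree_val d s L 0 (\<lambda>u. affine_val (d 0) (T' u) x))"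
    if "\<forall>k<n+m. \<forall>a\<le>d 0. \<theta> $ (k * (d 0 + 1) + a) = (\<Sum>u\<in>\<alpha> k. T' u a)" for \<theta> T'
    using trop_rat_eq_tree_val[OF g h that] by (intro extensionalityI[of _ "carrier_vec (d 0)"]) (auto simp: trop_rat_def)
  have "{trop_rat (d 0) n m \<theta> | \<theta>. \<theta> \<in> {\<theta> \<in> carrier_vec ?N. \<Phi> \<theta>}} = tree_funs d s L"
  proof (intro subset_antisym subsetI)
    fix f assume "f \<in> {trop_rat (d 0) n m \<theta> | \<theta>. \<theta> \<in> {\<theta> \<in> carrier_vec ?N. \<Phi> \<theta>}}"
    then show "f \<in> tree_funs d s L" unfolding tree_funs_def \<Phi>_def using val by blast
  next
    fix f assume "f \<in> tree_funs d s L"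
    then obtain T' where R: "realizable d L T'"
      and f: "f = (\<lambda>x\<in>carrier_vec (d 0). tree_val d s L 0 (\<lambda>u. affine_val (d 0) (T' u) x))"
      unfolding tree_funs_def by blast
    define \<theta> where "\<theta> = vec ?N (\<lambda>k. \<Sum>u\<in>\<alpha> (k div (d 0 + 1)). T' u (k mod (d 0 + 1)))"
    have \<theta>: "\<theta> $ (k * (d 0 + 1) + a) = (\<Sum>u\<in>\<alpha> k. T' u a)" if "k < n + m" "a \<le> d 0" for k a
    proof -
      have "(k * (d 0 + 1) + a) div (d 0 + 1) = k" "(k * (d 0 + 1) + a) mod (d 0 + 1) = a"
        using that(2) by (simp_all add: div_mult_self3 del: mult_Suc_right)
      then show ?thesis using index[OF that] unfolding \<theta>_def by (simp only: index_vec)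
    qed
    have T: "T \<theta> u a = T' u a" if u: "u \<in> paths d L" "a \<le> d 0" for u a
    proof -
      have "finite (\<alpha> (q u))" using pq[OF u(1)] g fin by blast
      then have "(\<Sum>v\<in>\<alpha> (p u). T' v a) = T' u a + (\<Sum>v\<in>\<alpha> (q u). T' v a)"
        using pq[OF u(1)] by simp
      moreover have "p u < n + m" "q u < n + m" using pq[OF u(1)] by auto
      ultimately show ?thesis unfolding T_def by (simp only: \<theta> u(2))
    qed
    have "realizable d L (T \<theta>)"
      using R unfolding realizable_def by (simp add: T append_in_paths)
    moreover have "(\<Sum>u\<in>\<alpha> k. T \<theta> u a) = (\<Sum>u\<in>\<alpha> k. T' u a)" if "k < n + m" "a \<le> d 0" for k a
      using \<alpha>_piece[OF that(1)] pieces_subset(1) that(2) by (intro sum.cong refl T) blast+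
    ultimately have "\<Phi> \<theta>" unfolding \<Phi>_def using \<theta> by simp
    moreover have "\<theta> \<in> carrier_vec ?N" by (simp add: \<theta>_def)
    moreover have "f = trop_rat (d 0) n m \<theta>" 
    proof -
      have "\<forall>k<n+m. \<forall>a\<le>d 0. \<theta> $ (k * (d 0 + 1) + a) = (\<Sum>u\<in>\<alpha> k. T' u a)"
        using \<theta> by blast
      from val[OF this] show ?thesis unfolding f by (rule sym)
    qed
    ultimately show "f \<in> {trop_rat (d 0) n m \<theta> | \<theta>. \<theta> \<in> {\<theta> \<in> carrier_vec ?N. \<Phi> \<theta>}}" by blast
  qed
  with semi show ?thesis by (intro exI[of _ "{\<theta> \<in> carrier_vec ?N. \<Phi> \<theta>}"]) (auto simp: Theta_def)
qed

theorem theorem3p2: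
  fixes L :: nat and d :: "nat \<Rightarrow> nat"
  assumes "L \<ge> 1"
    and "\<forall>l\<le>L. d l \<ge> 1"
    and "d L = 1"
  shows "\<exists>n m :: nat. n \<ge> 1 \<and> m \<ge> 1 \<and> n = 2 * m \<and>
     log 2 (real m) \<le> (\<Sum>k=1..L-1. 2 ^ (L - 1 - k) * (\<Prod>l=k..L-1. real (d l))) \<and>
     (\<forall>f\<in>ReLU_scalar d L. \<exists>\<theta>\<in>Theta (d 0) n m. f = trop_rat (d 0) n m \<theta>) \<and>
     (\<exists>S. S \<subseteq> Theta (d 0) n m \<and>
          semialgebraic_deg_le ((n + m) * (d 0 + 1)) (L + 1) S \<and>
          {trop_rat (d 0) n m \<theta> | \<theta>. \<theta> \<in> S} = ReLU_scalar d L)"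
proof -
  define m :: nat where "m = 2 ^ card (paths d L - {[]})"
  define n where "n = 2 * m"
  have "card (paths d L) = Suc (card (paths d L - {[]}))"
    using card.remove[OF finite_paths Nil_in_paths[OF assms(1)]] by simp
  then have n: "n \<ge> 2 ^ card (paths d L)" by (simp add: n_def m_def)
  have bound: "log 2 (real m) \<le> (\<Sum>k=1..L-1. 2 ^ (L - 1 - k) * (\<Prod>l=k..L-1. real (d l)))"
    using card_paths_bound[of d "L - 1"] assms(1) by (simp add: m_def log_nat_power)
  have "L + 1 \<ge> 2" using assms(1) by simp
  then have ex: "\<forall>s. \<exists>S. S \<subseteq> Theta (d 0) n m \<and> semialgebraic_deg_le ((n + m) * (d 0 + 1)) (L + 1) S \<and>
    {trop_rat (d 0) n m \<theta> | \<theta>. \<theta> \<in> S} = tree_funs d s L"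
    using tree_funs_semialgebraic[OF n, of m "L + 1"] by (simp add: m_def)
  from choice[OF ex] obtain S where choice: "\<forall>s. S s \<subseteq> Theta (d 0) n m \<and>
    semialgebraic_deg_le ((n + m) * (d 0 + 1)) (L + 1) (S s) \<and>
    {trop_rat (d 0) n m \<theta> | \<theta>. \<theta> \<in> S s} = tree_funs d s L" ..
  note S = choice[rule_format, THEN conjunct1] choice[rule_format, THEN conjunct2, THEN conjunct1]
    choice[rule_format, THEN conjunct2, THEN conjunct2]
  let ?S = "\<Union>s\<in>Pow (edges d L). S s"
  have "finite (Pow (edges d L))" by (simp add: edges_def)
  then have semi: "semialgebraic_deg_le ((n + m) * (d 0 + 1)) (L + 1) ?S"
    using S(2) by (rule semialgebraic_UN)
  have sub: "?S \<subseteq> Theta (d 0) n m" using S(1) by blast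
  have "{trop_rat (d 0) n m \<theta> | \<theta>. \<theta> \<in> ?S} = (\<Union>s\<in>Pow (edges d L). {trop_rat (d 0) n m \<theta> | \<theta>. \<theta> \<in> S s})"
    by blast
  then have img: "{trop_rat (d 0) n m \<theta> | \<theta>. \<theta> \<in> ?S} = ReLU_scalar d L"
    by (simp only: S(3) ReLU_scalar_eq_tree_funs[of L d, OF assms(1,3)])
  then have "\<forall>f\<in>ReLU_scalar d L. \<exists>\<theta>\<in>Theta (d 0) n m. f = trop_rat (d 0) n m \<theta>"
    using sub by blast
  moreover have "n \<ge> 1" "m \<ge> 1" by (simp_all add: n_def m_def)
  ultimately show ?thesis
    using n_def bound semi sub img by (intro exI[of _ n] exI[of _ m] conjI exI[of _ ?S])
qed

end
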